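(* Let $L\subset\mathbb R^2$ be the union of a finite number (at least one) of $2$-simplices. There exists a Cantor set $K\subset\mathbb R^2$ such that $p_\ell(K)=p_\ell(L)$ for each straight line $\ell\subset\mathbb R^2$.
   Context: A Cantor set is any topological space homeomorphic to the standard middle-thirds Cantor set. $p_\ell:\mathbb R^2\to\ell$ is the orthogonal projection onto the line $\ell$. A $2$-simplex is a non-degenerate closed triangle together with its interior. *)

theory Defs
  imports "HOL-Analysis.Analysis"
begin

text \<open>The middle-thirds construction: \<open>C\<^sub>0 = [0,1]\<close>, and each step replaces \<open>[0,1]\<close> by its
  outer thirds, i.e. takes the union of the images of the previous stage under the
  similarities \<open>x \<mapsto> x/3\<close> and \<open>x \<mapsto> (2 + x)/3\<close>.\<close>

primrec middle_thirds_stage :: "nat \<Rightarrow> real set" where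
  "middle_thirds_stage 0 = {0..1}"
| "middle_thirds_stage (Suc n) =
     (\<lambda>x. x / 3) ` middle_thirds_stage n \<union> (\<lambda>x. (2 + x) / 3) ` middle_thirds_stage n"

definition middle_thirds_set :: "real set" where
  "middle_thirds_set = (\<Inter>n. middle_thirds_stage n)"

definition cantor_set :: "'a::topological_space set \<Rightarrow> bool" where
  "cantor_set K \<longleftrightarrow> K homeomorphic middle_thirds_set"

definition orth_proj :: "'a::euclidean_space set \<Rightarrow> 'a \<Rightarrow> 'a" where
  "orth_proj l x = (THE y. y \<in> l \<and> (\<forall>z\<in>l. (x - y) \<bullet> (z - y) = 0))"

text \<open>On nonempty affine subspaces, in particular on lines, the description above is
  satisfied by exactly one point.\<close>

lemma ex1_orth_proj:
  fixes l :: "'a::euclidean_space set"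
  assumes "affine l" and "l \<noteq> {}"
  shows "\<exists>!y. y \<in> l \<and> (\<forall>z\<in>l. (x - y) \<bullet> (z - y) = 0)"
proof -
  have cl: "closed l" and cv: "convex l"
    using assms(1) by (auto simp: affine_closed affine_imp_convex)
  define y where "y = closest_point l x"
  have y: "y \<in> l"
    using closest_point_in_set[OF cl assms(2)] by (simp add: y_def)
  have le: "(x - y) \<bullet> (z - y) \<le> 0" if "z \<in> l" for z
    using closest_point_dot[OF cv cl that] by (simp add: y_def)
  have "(x - y) \<bullet> (z - y) = 0" if z: "z \<in> l" for z
  proof -
    have "2 *\<^sub>R y + (-1) *\<^sub>R z \<in> l"
      by (rule mem_affine[OF assms(1) y z]) simp
    from le[OF this] have "(x - y) \<bullet> (y - z) \<le> 0"
      by (simp add: scaleR_2 algebra_simps)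
    with le[OF z] show ?thesis
      by (simp add: inner_diff_right)
  qed
  moreover have "w = y" if "w \<in> l" and "\<forall>z\<in>l. (x - w) \<bullet> (z - w) = 0"
    and "\<forall>z\<in>l. (x - y) \<bullet> (z - y) = 0" for w
  proof -
    have "(x - w) \<bullet> (y - w) = 0" "(x - y) \<bullet> (w - y) = 0"
      using that y by auto
    then have "(y - w) \<bullet> (y - w) = 0"
      by (simp add: inner_diff_left inner_diff_right inner_commute)
    then show ?thesis by simp
  qed
  ultimately show ?thesis using y by blast
qed

end

theory Submission
  imports Defs
begin

text \<open>Let \<open>g\<close> be the centroid of a triangle \<open>abc\<close>. Contracting towards \<open>a\<close>, \<open>g\<close> and \<open>c\<close> with
  ratio \<open>2/5 < 1/2\<close> gives disjoint copies of the triangle \<open>agc\<close>, so the attractor is a Cantor set.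
  If a linear functional \<open>f\<close> satisfies \<open>f a \<le> f b \<le> f c\<close>, then \<open>f g\<close> lies in the middle third of
  \<open>[f a, f c]\<close>, and the three copies of that interval, scaled by \<open>2/5\<close>, cover it; hence \<open>f\<close> takes
  on the attractor all the values it takes on \<open>abc\<close>. The union of the attractors for the three
  sides therefore has the projections of the triangle. A finite union of such sets is again
  compact, perfect and totally disconnected, hence a Cantor set by Brouwer's theorem.\<close>

section \<open>Zero-dimensional sets and their finite unions\<close>

text \<open>For compact sets this is zero-dimensionality: the identity is a uniform limit of locally
  constant maps \<open>c\<close>, whose fibres are the chunks. The uniform \<open>d\<close> makes finite unions easy.\<close>

definition small_chunks :: "'a::metric_space set \<Rightarrow> bool" where
  "small_chunks K \<longleftrightarrow> (\<forall>e>0. \<exists>d>0. \<exists>c :: 'a \<Rightarrow> 'a.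
     \<forall>x\<in>K. dist x (c x) < e \<and> (\<forall>y\<in>K. dist x y < d \<longrightarrow> c x = c y))"

lemma small_chunksE:
  assumes "small_chunks K" "e > 0"
  obtains d c where "d > 0" "\<And>x. x \<in> K \<Longrightarrow> dist x (c x) < e"
    "\<And>x y. x \<in> K \<Longrightarrow> y \<in> K \<Longrightarrow> dist x y < d \<Longrightarrow> c x = c y"
  using assms unfolding small_chunks_def by metis

lemma small_chunks_empty: "small_chunks {}"
  unfolding small_chunks_def by (auto intro: exI[of _ 1])

lemma small_chunks_Un:
  fixes A B :: "'a::metric_space set"
  assumes "small_chunks A" "small_chunks B"
  shows "small_chunks (A \<union> B)"
  unfolding small_chunks_def
proof (intro allI impI)
  fix e :: real assume e: "e > 0"
  obtain dA cA where dA: "dA > 0" and cA: "\<And>x. x \<in> A \<Longrightarrow> dist x (cA x) < e / 2"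
    and lA: "\<And>x y. x \<in> A \<Longrightarrow> y \<in> A \<Longrightarrow> dist x y < dA \<Longrightarrow> cA x = cA y"
    using small_chunksE[OF assms(1), of "e / 2"] e by (metis half_gt_zero)
  \<comment> \<open>A chunk of \<open>B\<close> is so small that it comes close to at most one chunk of \<open>A\<close>; it is merged
    into that one.\<close>
  define h where "h = min e dA / 10"
  have h: "h > 0" "10 * h \<le> e" "10 * h \<le> dA" using e dA by (auto simp: h_def)
  obtain dB cB where dB: "dB > 0" and cB: "\<And>x. x \<in> B \<Longrightarrow> dist x (cB x) < h"
    and lB: "\<And>x y. x \<in> B \<Longrightarrow> y \<in> B \<Longrightarrow> dist x y < dB \<Longrightarrow> cB x = cB y"
    using small_chunksE[OF assms(2) h(1)] by metis
  \<comment> \<open>A point \<open>a\<close> of \<open>A\<close> whose chunk \<open>x\<close> may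
    join: either \<open>x\<close> itself or a point close to the \<open>B\<close>-chunk of
    \<open>x\<close>.\<close>
  define near where "near x a \<longleftrightarrow> a \<in> A \<and>
      (x = a \<or> x \<in> B \<and> (\<exists>b\<in>B. cB b = cB x \<and> dist b a < h))" for x a
  define d where "d = min dB h"
  define c where "c x = (if \<exists>a. near x a then cA (SOME a. near x a) else cB x)" for x
  \<comment> \<open>Two points of one \<open>B\<close>-chunk are within \<open>2 * h\<close> of each
    other through their common value of \<open>cB\<close>; the third \<open>h\<close> leads on to
    \<open>a\<close>.\<close>
  have near_dist: "dist x a < 3 * h" if n: "near x a" for x a
  proof (cases "x = a")
    case False
    then obtain b where b: "x \<in> B" "b \<in> B" "cB b = cB x" "dist b a < h"
      using n by (auto simp: near_def)
    show ?thesis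
      using cB[OF b(1)] cB[OF b(2)] b(3,4) dist_triangle[of x a b] dist_triangle2[of x b "cB x"]
      by simp
  qed (use h in auto)
  \<comment> \<open>The choice made by \<open>SOME\<close> does not matter: two candidates for
    \<open>x\<close> are less than \<open>6 * h\<close> apart, which is below \<open>dA\<close>, so
    \<open>cA\<close> agrees on them.\<close>
  have c_near: "c x = cA a" if n: "near x a" for x a
  proof -
    define a' where "a' = (SOME a. near x a)"
    have n': "near x a'" unfolding a'_def using n by (rule someI)
    have "dist a' a < dA"
      using near_dist[OF n] near_dist[OF n'] dist_triangle3[of a' a x] h by simp
    then have "cA a' = cA a" using n n' by (intro lA) (auto simp: near_def)
    then show ?thesis using n by (auto simp: c_def a'_def)
  qed
  show "\<exists>d>0. \<exists>c :: 'a \<Rightarrow> 'a. \<forall>x\<in>A \<union> B. dist x (c x) < e \<and>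
      (\<forall>y\<in>A \<union> B. dist x y < d \<longrightarrow> c x = c y)"
  proof (intro exI conjI ballI impI)
    show "d > 0" using dB h by (auto simp: d_def)
  next
    fix x assume x: "x \<in> A \<union> B"
    show "dist x (c x) < e"
    proof (cases "\<exists>a. near x a")
      case True
      then obtain a where a: "near x a" by blast
      then have "a \<in> A" by (auto simp: near_def)
      then show ?thesis
        using near_dist[OF a] cA[of a] dist_triangle[of x "cA a" a] h
        by (simp add: c_near[OF a])
    next
      case False
      then have "x \<in> B" using x by (auto simp: near_def)
      then show ?thesis using cB[of x] False h e by (simp add: c_def)
    qed
  next
    fix x y assume x: "x \<in> A \<union> B" and y: "y \<in> A \<union> B" and xy: "dist x y < d"
    \<comment> \<open>Having a candidate in \<open>A\<close> is constant at scale \<open>d\<close>.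
      The bound \<open>dB\<close> keeps two points of \<open>B\<close> in one chunk; the bound
      \<open>h\<close> handles \<open>x = a\<close>, where \<open>y\<close> itself is the point of
      its chunk close to \<open>a\<close>.\<close>
    have transfer: "\<exists>a. near y a"
      if n: "near x a" and x: "x \<in> A \<union> B" and y: "y \<in> A \<union> B" and xy: "dist x y < d" for x y a
    proof (cases "y \<in> A")
      case True
      then show ?thesis by (auto simp: near_def)
    next
      case False
      then have yB: "y \<in> B" using y by simp
      show ?thesis
      proof (cases "x = a")
        case True
        then have "near y a" using n yB xy by (auto simp: near_def d_def dist_commute)
        then show ?thesis ..
      next
        case False
        then obtain b where b: "x \<in> B" "b \<in> B" "cB b = cB x" "dist b a < h" "a \<in> A"
          using n by (auto simp: near_def)
        moreover have "cB x = cB y" using lB[OF b(1) yB] xy by (simp add: d_def)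
        ultimately have "near y a" using yB by (auto simp: near_def)
        then show ?thesis ..
      qed
    qed
    show "c x = c y"
    proof (cases "\<exists>a. near x a")
      case True
      then obtain a where a: "near x a" by blast
      obtain a' where a': "near y a'" using transfer[OF a x y xy] by blast
      have "dist a a' \<le> dist x a + dist x y + dist y a'"
        using dist_triangle[of a a' x] dist_triangle[of x a' y] by (simp add: dist_commute)
      then have "dist a a' < dA"
        using near_dist[OF a] near_dist[OF a'] xy h by (simp add: d_def)
      then have "cA a = cA a'" using a a' by (intro lA) (auto simp: near_def)
      then show ?thesis using c_near[OF a] c_near[OF a'] by simp
    next
      case False
      then have F: "\<nexists>a. near y a" using transfer[of y _ x] x y xy by (auto simp: dist_commute)
      have "x \<in> B" "y \<in> B" using False F x y by (auto simp: near_def)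
      then have "cB x = cB y" using lB xy by (simp add: d_def)
      then show ?thesis using False F by (simp add: c_def)
    qed
  qed
qed

lemma small_chunks_UN:
  assumes "finite I" "\<And>i. i \<in> I \<Longrightarrow> small_chunks (K i)"
  shows "small_chunks (\<Union>i\<in>I. K i)"
  using assms by (induction I) (simp_all add: small_chunks_empty small_chunks_Un)

subsection \<open>Brouwer's characterisation of the Cantor set\<close>

definition splits :: "'a set \<Rightarrow> 'a set \<Rightarrow> bool" where
  "splits B S \<longleftrightarrow> S \<inter> B \<noteq> {} \<and> S - B \<noteq> {}"

text \<open>A cell is always split by the first set of the sequence that splits it; hence a cell
  of depth \<open>n\<close> is split by none of the first \<open>n\<close> sets.\<close>

definition splitter :: "(nat \<Rightarrow> 'a set) \<Rightarrow> 'a set \<Rightarrow> 'a set" where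
  "splitter B S = B (LEAST m. splits (B m) S)"

primrec cell :: "(nat \<Rightarrow> 'a set) \<Rightarrow> 'a set \<Rightarrow> (nat \<Rightarrow> bool) \<Rightarrow> nat \<Rightarrow> 'a set" where
  "cell B K s 0 = K"
| "cell B K s (Suc n) = {x \<in> cell B K s n. x \<in> splitter B (cell B K s n) \<longleftrightarrow> s n}"

text \<open>The same tree addressed by a point instead of a branch. It comes before
  \<open>code\<close>, which is read off from it; \<open>cell_at_code\<close> then identifies the
  two descriptions.\<close>

primrec cell_at :: "(nat \<Rightarrow> 'a set) \<Rightarrow> 'a set \<Rightarrow> 'a \<Rightarrow> nat \<Rightarrow> 'a set" where
  "cell_at B K x 0 = K"
| "cell_at B K x (Suc n) =
     {y \<in> cell_at B K x n. y \<in> splitter B (cell_at B K x n) \<longleftrightarrow> x \<in> splitter B (cell_at B K x n)}"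

definition code :: "(nat \<Rightarrow> 'a set) \<Rightarrow> 'a set \<Rightarrow> 'a \<Rightarrow> nat \<Rightarrow> bool" where
  "code B K x n \<longleftrightarrow> x \<in> splitter B (cell_at B K x n)"

text \<open>For compact \<open>K\<close> these are the relatively clopen subsets. The uniform gap
  \<open>d\<close> is stored because it serves directly as a modulus of continuity.\<close>

definition uclopen :: "'a::metric_space set \<Rightarrow> 'a set \<Rightarrow> bool" where
  "uclopen K U \<longleftrightarrow> U \<subseteq> K \<and> (\<exists>d>0. \<forall>x\<in>U. \<forall>y\<in>K - U. d \<le> dist x y)"

lemma uclopenE:
  assumes "uclopen K U"
  obtains d where "d > 0" "\<And>x y. x \<in> U \<Longrightarrow> y \<in> K - U \<Longrightarrow> d \<le> dist x y"
  using assms unfolding uclopen_def by blast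

lemma uclopen_refl: "uclopen K K"
  by (auto simp: uclopen_def intro: exI[of _ 1])

lemma uclopen_Diff: "uclopen K U \<Longrightarrow> uclopen K (K - U)"
  unfolding uclopen_def by (metis Diff_subset dist_commute double_diff order_refl)

lemma uclopen_Int:
  assumes "uclopen K U" "uclopen K V"
  shows "uclopen K (U \<inter> V)"
proof -
  obtain d where d: "d > 0" "\<And>x y. x \<in> U \<Longrightarrow> y \<in> K - U \<Longrightarrow> d \<le> dist x y"
    using uclopenE[OF assms(1)] by metis
  obtain d' where d': "d' > 0" "\<And>x y. x \<in> V \<Longrightarrow> y \<in> K - V \<Longrightarrow> d' \<le> dist x y"
    using uclopenE[OF assms(2)] by metis
  have "min d d' \<le> dist x y" if "x \<in> U \<inter> V" "y \<in> K - U \<inter> V" for x y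
    using that d(2)[of x y] d'(2)[of x y] by force
  then show ?thesis
    unfolding uclopen_def using assms d(1) d'(1)
    by (metis min_less_iff_conj uclopen_def le_infI1)
qed

lemma uclopen_compact:
  assumes "compact K" "uclopen K U"
  shows "compact U"
proof -
  obtain d where d: "d > 0" "\<And>x y. x \<in> U \<Longrightarrow> y \<in> K - U \<Longrightarrow> d \<le> dist x y"
    using uclopenE[OF assms(2)] by metis
  have "U \<subseteq> K" using assms(2) by (simp add: uclopen_def)
  have "U = K - (\<Union>y\<in>K - U. ball y d)"
    using d \<open>U \<subseteq> K\<close> by (force simp: dist_commute)
  then show ?thesis using assms(1) by (metis compact_diff open_UN open_ball)
qed

lemma cell_at_self: "x \<in> K \<Longrightarrow> x \<in> cell_at B K x n"
  by (induction n) auto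

lemma cell_at_eq: "y \<in> cell_at B K x n \<Longrightarrow> cell_at B K y n = cell_at B K x n"
  by (induction n) auto

lemma cell_at_code: "cell B K (code B K x) n = cell_at B K x n"
  by (induction n) (auto simp: code_def)

lemma cell_at_of_cell: "x \<in> cell B K s n \<Longrightarrow> cell_at B K x n = cell B K s n"
  by (induction n) auto

lemma code_of_cell:
  assumes "\<And>n. x \<in> cell B K s n"
  shows "code B K x = s"
proof
  fix n
  have "x \<in> splitter B (cell B K s n) \<longleftrightarrow> s n" using assms[of "Suc n"] by simp
  then show "code B K x n = s n" using cell_at_of_cell[OF assms[of n]] by (simp add: code_def)
qed

lemma cell_subset: "cell B K s n \<subseteq> K"
  by (induction n) auto

text \<open>Subsets of an unsplit set are unsplit, so each step only has to deal with
  \<open>B n\<close>. If it splits the cell, the induction hypothesis makes it the first to do so,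
  hence the splitter, and the next cell lies on one side of it.\<close>

lemma not_splits_cell: "k < n \<Longrightarrow> \<not> splits (B k) (cell B K s n)"
proof (induction n arbitrary: k)
  case (Suc n)
  let ?C = "cell B K s n" and ?m = "LEAST m. splits (B m) (cell B K s n)"
  show ?case
  proof (cases "k < n")
    case True
    then show ?thesis using Suc.IH[of k] unfolding splits_def by auto
  next
    case False
    then have k: "k = n" using Suc.prems by simp
    show ?thesis
    proof (cases "splits (B n) ?C")
      case True
      then have "?m \<le> n" by (rule Least_le)
      moreover have "splits (B ?m) ?C" using True by (rule LeastI)
      ultimately have "?m = n" using Suc.IH by (metis nless_le)
      then have "splitter B ?C = B n" by (simp add: splitter_def)
      then show ?thesis unfolding k by (auto simp: splits_def)
    next
      case False
      then show ?thesis unfolding k splits_def by auto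
    qed
  qed
qed simp

lemma uclopen_cell:
  fixes B :: "nat \<Rightarrow> 'a::metric_space set"
  assumes "\<And>m. uclopen K (B m)"
  shows "uclopen K (cell B K s n)"
proof (induction n)
  case (Suc n)
  let ?S = "splitter B (cell B K s n)"
  have "uclopen K ?S" using assms by (simp add: splitter_def)
  then have "uclopen K (cell B K s n \<inter> ?S)" "uclopen K (cell B K s n \<inter> (K - ?S))"
    using Suc uclopen_Int uclopen_Diff by blast+
  moreover have "cell B K s (Suc n) = (if s n then cell B K s n \<inter> ?S else cell B K s n \<inter> (K - ?S))"
    using cell_subset[of B K s n] by auto
  ultimately show ?case by presburger
qed (simp add: uclopen_refl)

text \<open>A cell is never a single point: the gap around it captures a second point of the perfect
  set \<open>K\<close>. Some \<open>B m\<close> separates the two, so the \<open>LEAST\<close> in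
  \<open>splitter\<close> is attained and both halves are inhabited.\<close>

lemma cell_nonempty:
  fixes K :: "'a::metric_space set" and B :: "nat \<Rightarrow> 'a set"
  assumes "K \<noteq> {}" and clopen: "\<And>m. uclopen K (B m)"
    and sep: "\<And>x y. x \<in> K \<Longrightarrow> y \<in> K \<Longrightarrow> x \<noteq> y \<Longrightarrow> \<exists>m. x \<in> B m \<and> y \<notin> B m"
    and perfect: "\<And>x. x \<in> K \<Longrightarrow> x islimpt K"
  shows "cell B K s n \<noteq> {}"
proof (induction n)
  case (Suc n)
  let ?C = "cell B K s n"
  obtain x where x: "x \<in> ?C" using Suc by blast
  obtain d where d: "d > 0" "\<And>u v. u \<in> ?C \<Longrightarrow> v \<in> K - ?C \<Longrightarrow> d \<le> dist u v"
    using uclopenE[OF uclopen_cell[of K B s n, OF clopen]] by metis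
  obtain y where y: "y \<in> K" "y \<noteq> x" "dist y x < d"
    using perfect[of x] x d(1) cell_subset[of B K s n] unfolding islimpt_approachable by blast
  then have "y \<in> ?C" using d(2)[OF x, of y] by (force simp: dist_commute)
  moreover obtain m where "x \<in> B m" "y \<notin> B m"
    using sep[of x y] x y cell_subset[of B K s n] by blast
  ultimately have "splits (B m) ?C" using x by (auto simp: splits_def)
  then have "splits (splitter B ?C) ?C" unfolding splitter_def by (rule LeastI)
  then show ?case by (auto simp: splits_def)
qed (use assms in auto)

text \<open>The code is a continuous bijection from a compact space onto a Hausdorff one. It is onto
  because the cells of a branch are nested nonempty compact sets, and injective because the sequence
  \<open>B\<close> separates points.\<close>

lemma cantor_scheme_homeomorphic:
  fixes K :: "'a::metric_space set" and B :: "nat \<Rightarrow> 'a set"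
  assumes K: "compact K" "K \<noteq> {}" and clopen: "\<And>m. uclopen K (B m)"
    and sep: "\<And>x y. x \<in> K \<Longrightarrow> y \<in> K \<Longrightarrow> x \<noteq> y \<Longrightarrow> \<exists>m. x \<in> B m \<and> y \<notin> B m"
    and perfect: "\<And>x. x \<in> K \<Longrightarrow> x islimpt K"
  shows "K homeomorphic {f :: nat \<Rightarrow> real. \<forall>n. f n \<in> {0, 1}}"
proof -
  define \<phi> where "\<phi> x n = (of_bool (code B K x n) :: real)" for x n
  have "continuous_on K (\<lambda>x. \<phi> x n)" for n
    unfolding continuous_on_iff
  proof (intro ballI allI impI)
    fix x :: 'a and e :: real assume x: "x \<in> K" and e: "e > 0"
    \<comment> \<open>Digit \<open>n\<close> is decided in passing from depth \<open>n\<close> to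
      \<open>Suc n\<close>, so it is constant on this cell.\<close>
    let ?C = "cell_at B K x (Suc n)"
    have "uclopen K ?C" 
      using uclopen_cell[of K B "code B K x" "Suc n", OF clopen] by (simp only: cell_at_code)
    then obtain d where d: "d > 0" "\<And>u v. u \<in> ?C \<Longrightarrow> v \<in> K - ?C \<Longrightarrow> d \<le> dist u v"
      using uclopenE by metis
    have "\<phi> y n = \<phi> x n" if y: "y \<in> K" "dist y x < d" for y
    proof -
      have yC: "y \<in> ?C" using d(2)[of x y] cell_at_self[OF x] y by (force simp: dist_commute)
      then have "cell_at B K y n = cell_at B K x n" by (intro cell_at_eq) simp
      then show ?thesis using yC by (simp add: \<phi>_def code_def)
    qed
    then show "\<exists>d>0. \<forall>x'\<in>K. dist x' x < d \<longrightarrow> dist (\<phi> x' n) (\<phi> x n) < e"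
      using d(1) e by (metis dist_self)
  qed
  then have "continuous_on K \<phi>" by (rule continuous_on_coordinatewise_then_product)
  moreover have "\<phi> ` K = {f. \<forall>n. f n \<in> {0, 1}}"
  proof (intro equalityI subsetI)
    fix f :: "nat \<Rightarrow> real" assume f: "f \<in> {f. \<forall>n. f n \<in> {0, 1}}"
    define s where "s n \<longleftrightarrow> f n = 1" for n
    have anti: "cell B K s n \<subseteq> cell B K s m" if "m \<le> n" for m n
      using that by (induction rule: dec_induct) auto
    have ne: "cell B K s n \<noteq> {}" for n by (rule cell_nonempty) (use assms in auto)
    have "K \<inter> (\<Inter>n\<in>UNIV. cell B K s n) \<noteq> {}"
    proof (rule compact_imp_fip_image[OF K(1)])
      show "closed (cell B K s n)" for n
        using uclopen_compact[OF K(1) uclopen_cell[OF clopen]] by (rule compact_imp_closed)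
      show "K \<inter> (\<Inter>n\<in>I. cell B K s n) \<noteq> {}" if "finite I" for I
      proof -
        obtain N where "\<forall>n\<in>I. n \<le> N" using \<open>finite I\<close> finite_nat_set_iff_bounded_le by auto
        then have "cell B K s N \<subseteq> K \<inter> (\<Inter>n\<in>I. cell B K s n)"
          using anti cell_subset[of B K s N] by blast
        then show ?thesis using ne by blast
      qed
    qed
    then obtain x where x: "\<And>n. x \<in> cell B K s n" by blast
    have "\<phi> x = f"
      using code_of_cell[OF x] f by (auto simp: \<phi>_def s_def fun_eq_iff)
    moreover have "x \<in> K" using x[of 0] by simp
    ultimately show "f \<in> \<phi> ` K" by blast
  qed (auto simp: \<phi>_def)
  moreover have "inj_on \<phi> K"
  proof (rule inj_onI, rule ccontr)
    fix x y assume xy: "x \<in> K" "y \<in> K" "\<phi> x = \<phi> y" "x \<noteq> y"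
    have c: "code B K x = code B K y"
    proof
      fix n
      have "\<phi> x n = \<phi> y n" using xy(3) by simp
      then show "code B K x n = code B K y n" by (simp add: \<phi>_def of_bool_def split: if_splits)
    qed
    obtain m where m: "x \<in> B m" "y \<notin> B m" using sep xy by blast
    \<comment> \<open>Equal codes put \<open>x\<close> and \<open>y\<close> in one cell at every
      depth; from depth \<open>Suc m\<close> on, \<open>B m\<close> splits no cell.\<close>
    let ?C = "cell B K (code B K x) (Suc m)"
    have "x \<in> ?C" using cell_at_self[OF xy(1)] by (simp only: cell_at_code)
    moreover have "y \<in> ?C" unfolding c using cell_at_self[OF xy(2)] by (simp only: cell_at_code)
    ultimately have "splits (B m) ?C" using m unfolding splits_def by blast
    then show False using not_splits_cell[of m "Suc m"] by blast
  qed
  ultimately show ?thesis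
    using homeomorphic_compact[OF K(1)] by blast
qed

text \<open>The sequence enumerates all chunks for the sizes \<open>1 / (n + 1)\<close>. There are
  finitely many of each size, since finitely many balls of radius \<open>d n\<close> cover
  \<open>K\<close> and \<open>c n\<close> is constant on each of them within
  \<open>K\<close>.\<close>

lemma small_chunks_separating_sequence:
  fixes K :: "'a::metric_space set"
  assumes K: "compact K" "K \<noteq> {}" "small_chunks K"
  obtains B :: "nat \<Rightarrow> 'a set" where "\<And>m. uclopen K (B m)"
    "\<And>x y. x \<in> K \<Longrightarrow> y \<in> K \<Longrightarrow> x \<noteq> y \<Longrightarrow> \<exists>m. x \<in> B m \<and> y \<notin> B m"
proof -
  have "\<forall>n. \<exists>d c. d > 0 \<and> (\<forall>x\<in>K. dist x (c x) < inverse (real (Suc n)) \<and>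
      (\<forall>y\<in>K. dist x y < d \<longrightarrow> c x = c y))"
    using K(3) unfolding small_chunks_def by (metis inverse_positive_iff_positive of_nat_0_less_iff zero_less_Suc)
  then obtain d c where d: "\<And>n. d n > 0"
    and c: "\<And>n x. x \<in> K \<Longrightarrow> dist x (c n x) < inverse (real (Suc n))"
    and l: "\<And>n x y. x \<in> K \<Longrightarrow> y \<in> K \<Longrightarrow> dist x y < d n \<Longrightarrow> c n x = c n y"
    by metis
  have fin: "finite (c n ` K)" for n
  proof -
    obtain N where N: "finite N" "N \<subseteq> K" "K \<subseteq> (\<Union>x\<in>N. ball x (d n))"
      using seq_compact_imp_totally_bounded[OF compact_imp_seq_compact[OF K(1)]] d[of n] by metis
    have "c n ` K \<subseteq> c n ` N"
    proof
      fix v assume "v \<in> c n ` K"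
      then obtain x where x: "x \<in> K" "v = c n x" by blast
      then obtain z where "z \<in> N" "dist z x < d n" using N(3) by force
      then have "c n z = c n x" using l x N(2) by blast
      then show "v \<in> c n ` N" using x(2) \<open>z \<in> N\<close> by (metis imageI)
    qed
    then show ?thesis using N(1) by (meson finite_imageI finite_subset)
  qed
  define \<B> where "\<B> = (\<Union>n. (\<lambda>v. {x\<in>K. c n x = v}) ` c n ` K)"
  have "countable \<B>" unfolding \<B>_def using fin by (auto intro: countable_finite)
  moreover have "\<B> \<noteq> {}" using K(2) by (auto simp: \<B>_def)
  ultimately have rng: "range (from_nat_into \<B>) = \<B>" by (rule range_from_nat_into[rotated])
  show thesis
  proof (rule that[of "from_nat_into \<B>"])
    fix m
    have "from_nat_into \<B> m \<in> \<B>" using \<open>\<B> \<noteq> {}\<close> by (rule from_nat_into)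
    then obtain n v where nv: "from_nat_into \<B> m = {x\<in>K. c n x = v}" unfolding \<B>_def by blast
    show "uclopen K (from_nat_into \<B> m)"
      unfolding nv uclopen_def
    proof (intro conjI exI[of _ "d n"] ballI)
      show "d n \<le> dist x y" if "x \<in> {x\<in>K. c n x = v}" "y \<in> K - {x\<in>K. c n x = v}" for x y
        using that l[of x y n] by fastforce
    qed (use d in auto)
  next
    fix x y assume xy: "x \<in> K" "y \<in> K" "x \<noteq> y"
    then obtain n where n: "inverse (real (Suc n)) < dist x y / 2"
      using reals_Archimedean[of "dist x y / 2"] by auto
    \<comment> \<open>A common value would lie within half of \<open>dist x y\<close> of both
      points.\<close>
    have "c n x \<noteq> c n y"
      using c[OF xy(1), of n] c[OF xy(2), of n] n dist_triangle2[of x y "c n x"] by auto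
    moreover have "{z\<in>K. c n z = c n x} \<in> \<B>" unfolding \<B>_def using xy by blast
    ultimately have "\<exists>U\<in>\<B>. x \<in> U \<and> y \<notin> U"
      by (intro bexI[of _ "{z\<in>K. c n z = c n x}"]) (use xy in auto)
    then show "\<exists>m. x \<in> from_nat_into \<B> m \<and> y \<notin> from_nat_into \<B> m"
      using rng by (metis imageE)
  qed
qed

lemma small_chunks_homeomorphic:
  fixes K :: "'a::metric_space set"
  assumes "compact K" "K \<noteq> {}" "small_chunks K" "\<And>x. x \<in> K \<Longrightarrow> x islimpt K"
  shows "K homeomorphic {f :: nat \<Rightarrow> real. \<forall>n. f n \<in> {0, 1}}"
proof (rule small_chunks_separating_sequence[OF assms(1-3)])
  fix B :: "nat \<Rightarrow> 'a set" assume B: "\<And>m. uclopen K (B m)"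
    "\<And>x y. x \<in> K \<Longrightarrow> y \<in> K \<Longrightarrow> x \<noteq> y \<Longrightarrow> \<exists>m. x \<in> B m \<and> y \<notin> B m"
  show ?thesis by (rule cantor_scheme_homeomorphic[OF assms(1,2) B assms(4)])
qed

subsection \<open>Attractors of homothetic contractions\<close>

definition contr :: "real \<Rightarrow> 'a::real_vector \<Rightarrow> 'a \<Rightarrow> 'a" where
  "contr r d x = r *\<^sub>R x + (1 - r) *\<^sub>R d"

text \<open>\<open>D\<close> supplies both the centres and the vertices of the initial hull. The
  hull is thus mapped into itself, so the stages decrease and the attractor can be taken as their
  intersection.\<close>

primrec stage :: "real \<Rightarrow> 'a::euclidean_space set \<Rightarrow> nat \<Rightarrow> 'a set" where
  "stage r D 0 = convex hull D"
| "stage r D (Suc n) = (\<Union>d\<in>D. contr r d ` stage r D n)"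

definition attractor :: "real \<Rightarrow> 'a::euclidean_space set \<Rightarrow> 'a set" where
  "attractor r D = (\<Inter>n. stage r D n)"

lemma dist_contr:
  fixes x :: "'a::real_normed_vector"
  shows "r \<ge> 0 \<Longrightarrow> dist (contr r d x) (contr r d y) = r * dist x y"
proof -
  assume "r \<ge> 0"
  have "contr r d x - contr r d y = r *\<^sub>R (x - y)" by (simp add: contr_def algebra_simps)
  then show ?thesis using \<open>r \<ge> 0\<close> by (simp add: dist_norm)
qed

lemma contr_inject: "r \<noteq> 0 \<Longrightarrow> contr r d x = contr r d y \<longleftrightarrow> x = y"
  by (simp add: contr_def)

lemma stage_Suc_subset:
  assumes "0 \<le> r" "r \<le> 1"
  shows "stage r D (Suc n) \<subseteq> stage r D n"
proof (induction n)
  case 0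
  show ?case
    using assms convexD[OF convex_convex_hull, of _ D _ r "1 - r"]
    by (auto simp: contr_def hull_inc)
next
  case (Suc n)
  show ?case
  proof
    fix x assume "x \<in> stage r D (Suc (Suc n))"
    then obtain d y where "d \<in> D" "y \<in> stage r D (Suc n)" "x = contr r d y" by auto
    moreover from this have "y \<in> stage r D n" using Suc.IH by blast
    ultimately show "x \<in> stage r D (Suc n)" by auto
  qed
qed

lemma stage_antimono:
  assumes "0 \<le> r" "r \<le> 1" "m \<le> n"
  shows "stage r D n \<subseteq> stage r D m"
  using lift_Suc_antimono_le[of "stage r D"] stage_Suc_subset[OF assms(1,2)] assms(3) by blast

lemma compact_stage: "finite D \<Longrightarrow> compact (stage r D n)"
  by (induction n) (auto simp: contr_def intro!: finite_imp_compact_convex_hull compact_UN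
      compact_continuous_image continuous_intros)

lemma compact_attractor: "finite D \<Longrightarrow> compact (attractor r D)"
  unfolding attractor_def using compact_stage by (intro compact_Inter) auto

lemma attractor_subset: "attractor r D \<subseteq> convex hull D"
  unfolding attractor_def by (metis INT_lower UNIV_I stage.simps(1))

text \<open>Each centre is the fixed point of its own contraction and so survives every
  stage.\<close>

lemma digits_subset_attractor: "D \<subseteq> attractor r D"
proof -
  have "d \<in> stage r D n" if "d \<in> D" for d n
  proof (induction n)
    case (Suc n)
    have "contr r d d = d" by (simp add: contr_def algebra_simps)
    then show ?case using Suc that by (metis UN_I image_eqI stage.simps(2))
  qed (simp add: hull_inc that)
  then show ?thesis by (auto simp: attractor_def)
qed

text \<open>A linear functional equal to \<open>1\<close> on \<open>d - e\<close> and to \<open>0\<close> on \<open>x - e\<close> for the other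
  vertices \<open>x\<close> separates the two images, as their ratio is less than \<open>1/2\<close>.\<close>

lemma contr_hull_disjoint:
  fixes D :: "'a::euclidean_space set"
  assumes indep: "\<not> affine_dependent D" and r: "0 < r" "r < 1/2" and de: "d \<in> D" "e \<in> D" "d \<noteq> e"
  shows "contr r d ` (convex hull D) \<inter> contr r e ` (convex hull D) = {}"
proof -
  have "insert e (D - {e}) = D" using de by auto
  then have "independent ((\<lambda>x. - e + x) ` (D - {e}))"
    using affine_dependent_iff_dependent[of e "D - {e}"] indep by auto
  from linear_independent_extend[OF this, of "\<lambda>x. if x = d - e then 1 else 0 :: real"]
  obtain g :: "'a \<Rightarrow> real" where g: "linear g"
    and ge: "\<And>x. x \<in> D - {e} \<Longrightarrow> g (x - e) = (if x = d then 1 else 0)"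
    by auto
  have gd: "g d = g e + 1" using ge[of d] de linear_diff[OF g] by simp
  have "convex hull D \<subseteq> g -` {g e..g e + 1}"
  proof (rule hull_minimal)
    show "D \<subseteq> g -` {g e..g e + 1}"
    proof
      fix x assume x: "x \<in> D"
      show "x \<in> g -` {g e..g e + 1}"
      proof (cases "x = e")
        case False
        then have "g x - g e = (if x = d then 1 else 0)" using ge[of x] x linear_diff[OF g] by simp
        then show ?thesis by (auto split: if_splits)
      qed auto
    qed
    show "convex (g -` {g e..g e + 1})" by (intro convex_linear_vimage g) auto
  qed
  then have hull: "g e \<le> g x" "g x \<le> g e + 1" if "x \<in> convex hull D" for x
    using that by auto
  have "contr r d x \<noteq> contr r e y" if x: "x \<in> convex hull D" and y: "y \<in> convex hull D" for x y
  proof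
    assume "contr r d x = contr r e y"
    then have "g (contr r d x) = g (contr r e y)" by simp
    then have "r * g x + (1 - r) * g d = r * g y + (1 - r) * g e"
      by (simp add: contr_def linear_add[OF g] linear_scale[OF g])
    then have "1 - r = r * (g y - g x)" by (simp add: gd algebra_simps)
    also have "\<dots> \<le> r * 1" using hull[OF x] hull[OF y] r by (intro mult_left_mono) auto
    finally show False using r by simp
  qed
  then show ?thesis by auto
qed

text \<open>A point of the attractor might a priori use a different contraction at each stage.
  Disjointness of the images of the hull forces the same one throughout, and injectivity then gives
  one preimage lying in all stages.\<close>

lemma attractor_unfold:
  fixes D :: "'a::euclidean_space set"
  assumes indep: "\<not> affine_dependent D" and r: "0 < r" "r < 1/2"
  shows "attractor r D = (\<Union>d\<in>D. contr r d ` attractor r D)"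
proof (intro equalityI subsetI)
  fix x assume x: "x \<in> attractor r D"
  then have "x \<in> stage r D (Suc 0)" unfolding attractor_def by blast
  then obtain d y where d: "d \<in> D" "y \<in> convex hull D" "x = contr r d y" by auto
  have "y \<in> stage r D n" for n
  proof -
    have "x \<in> stage r D (Suc n)" using x unfolding attractor_def by blast
    then obtain e z where e: "e \<in> D" "z \<in> stage r D n" "x = contr r e z" by auto
    then have "z \<in> convex hull D" using stage_antimono[of r 0 n D] r by auto
    then have "e = d" using contr_hull_disjoint[OF indep r e(1) d(1)] d(2,3) e(3) by blast
    then show ?thesis using d(3) e r by (simp add: contr_inject)
  qed
  then show "x \<in> (\<Union>d\<in>D. contr r d ` attractor r D)" using d by (auto simp: attractor_def)
next
  fix x assume "x \<in> (\<Union>d\<in>D. contr r d ` attractor r D)"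
  then obtain d y where d: "d \<in> D" "y \<in> attractor r D" "x = contr r d y" by blast
  then have "x \<in> stage r D (Suc n)" for n by (auto simp: attractor_def)
  then have "x \<in> stage r D n" for n using stage_Suc_subset[of r D n] r by auto
  then show "x \<in> attractor r D" by (auto simp: attractor_def)
qed

lemma attractorE:
  assumes "\<not> affine_dependent D" "0 < r" "r < 1/2" "x \<in> attractor r D"
  obtains d y where "d \<in> D" "y \<in> attractor r D" "x = contr r d y"
proof -
  have "x \<in> (\<Union>d\<in>D. contr r d ` attractor r D)"
    using assms(4) attractor_unfold[OF assms(1-3)] by metis
  then show thesis using that by blast
qed

lemma contr_mem_attractor:
  assumes "\<not> affine_dependent D" "0 < r" "r < 1/2" "d \<in> D" "y \<in> attractor r D"
  shows "contr r d y \<in> attractor r D"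
  by (subst attractor_unfold[OF assms(1-3)]) (use assms(4,5) in blast)

lemma power_times_less:
  fixes r :: real
  assumes "0 \<le> r" "r < 1" "0 < e"
  shows "\<exists>n. r ^ n * M < e"
proof -
  have "(\<lambda>n. r ^ n * M) \<longlonglongrightarrow> 0 * M"
    using assms by (intro tendsto_intros LIMSEQ_realpow_zero) auto
  then have "eventually (\<lambda>n. r ^ n * M < e) sequentially"
    using \<open>e > 0\<close> by (intro order_tendstoD(2)) auto
  then show ?thesis by (auto simp: eventually_sequentially)
qed

text \<open>Every point has another point of the attractor within the diameter \<open>M\<close>.
  Peeling off a contraction, finding a neighbour of the preimage and mapping it back improves the
  bound by the factor \<open>r\<close>.\<close>

lemma attractor_islimpt:
  fixes D :: "'a::euclidean_space set"
  assumes indep: "\<not> affine_dependent D" and r: "0 < r" "r < 1/2"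
    and D: "a \<in> D" "b \<in> D" "a \<noteq> b" and x: "x \<in> attractor r D"
  shows "x islimpt attractor r D"
proof -
  have fin: "finite D" using indep by (rule aff_independent_finite)
  define M where "M = diameter (attractor r D)"
  have bd: "bounded (attractor r D)" using compact_attractor[OF fin] by (rule compact_imp_bounded)
  have *: "\<exists>y\<in>attractor r D. y \<noteq> x \<and> dist y x \<le> r ^ n * M" if "x \<in> attractor r D" for n x
    using that
  proof (induction n arbitrary: x)
    case 0
    obtain y where "y \<in> D" "y \<noteq> x" using D by metis
    moreover have "y \<in> attractor r D" using \<open>y \<in> D\<close> digits_subset_attractor by blast
    ultimately show ?case
      using diameter_bounded_bound[OF bd, of y x] 0 unfolding M_def by auto
  next
    case (Suc n)
    obtain d u where d: "d \<in> D" "u \<in> attractor r D" "x = contr r d u"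
      using attractorE[OF indep r Suc.prems] .
    obtain v where v: "v \<in> attractor r D" "v \<noteq> u" "dist v u \<le> r ^ n * M"
      using Suc.IH[OF d(2)] by blast
    have "contr r d v \<in> attractor r D" using contr_mem_attractor[OF indep r d(1) v(1)] .
    moreover have "contr r d v \<noteq> x" using v(2) r d(3) by (simp add: contr_inject)
    moreover have "dist (contr r d v) x \<le> r ^ Suc n * M"
      using v(3) r by (simp add: d(3) dist_contr mult.assoc)
    ultimately show ?case by blast
  qed
  show ?thesis
    unfolding islimpt_approachable
  proof (intro allI impI)
    fix e :: real assume "e > 0"
    obtain n where "r ^ n * M < e"
      using power_times_less[of r e M] r \<open>e > 0\<close> by auto
    then show "\<exists>y\<in>attractor r D. y \<noteq> x \<and> dist y x < e" using *[OF x, of n] by force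
  qed
qed

lemma contr_hull_gap:
  fixes D :: "'a::euclidean_space set"
  assumes indep: "\<not> affine_dependent D" and r: "0 < r" "r < 1/2"
  obtains g where "g > 0" "\<And>d e x y. d \<in> D \<Longrightarrow> e \<in> D \<Longrightarrow> x \<in> convex hull D \<Longrightarrow> y \<in> convex hull D
    \<Longrightarrow> dist (contr r d x) (contr r e y) < g \<Longrightarrow> d = e"
proof -
  have fin: "finite D" using indep by (rule aff_independent_finite)
  have "\<exists>g>0. \<forall>x\<in>convex hull D. \<forall>y\<in>convex hull D. d \<noteq> e \<longrightarrow> g \<le> dist (contr r d x) (contr r e y)"
    if "d \<in> D" "e \<in> D" for d e
  proof (cases "d = e")
    case False
    have "compact (contr r d ` (convex hull D))" "closed (contr r e ` (convex hull D))"
      unfolding contr_def using finite_imp_compact_convex_hull[OF fin]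
      by (auto intro!: compact_imp_closed compact_continuous_image continuous_intros)
    then show ?thesis
      using separate_compact_closed contr_hull_disjoint[OF indep r that False] by (metis imageI)
  qed (auto intro: exI[of _ 1])
  then obtain g where g: "\<And>d e. d \<in> D \<Longrightarrow> e \<in> D \<Longrightarrow> g d e > 0"
    "\<And>d e x y. d \<in> D \<Longrightarrow> e \<in> D \<Longrightarrow> x \<in> convex hull D \<Longrightarrow> y \<in> convex hull D \<Longrightarrow> d \<noteq> e \<Longrightarrow>
      (g d e :: real) \<le> dist (contr r d x) (contr r e y)"
    by metis
  \<comment> \<open>The extra \<open>1\<close> keeps the minimum defined when \<open>D\<close> is
    empty.\<close>
  define m where "m = Min (insert 1 ((\<lambda>(d, e). g d e) ` (D \<times> D)))"
  have "m > 0" unfolding m_def using fin g(1) by (subst Min_gr_iff) auto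
  moreover have "m \<le> g d e" if "d \<in> D" "e \<in> D" for d e
    unfolding m_def using fin that by (intro Min_le) force+
  ultimately show thesis using g(2) that[of m] by (meson leD order_trans)
qed

text \<open>The chunks are the pieces of level \<open>n\<close>, of size at most
  \<open>r ^ n * M\<close>. A distance below the gap \<open>g\<close> forces the same first
  contraction; undoing it turns a distance below \<open>r * \<delta>\<close> into one below
  \<open>\<delta>\<close>, so the previous level applies.\<close>

lemma small_chunks_attractor:
  fixes D :: "'a::euclidean_space set"
  assumes indep: "\<not> affine_dependent D" and r: "0 < r" "r < 1/2" and "D \<noteq> {}"
  shows "small_chunks (attractor r D)"
proof -
  let ?K = "attractor r D"
  have fin: "finite D" using indep by (rule aff_independent_finite)
  define M where "M = diameter ?K"
  have bd: "bounded ?K" using compact_attractor[OF fin] by (rule compact_imp_bounded)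
  obtain g where g: "g > 0" "\<And>d e x y. d \<in> D \<Longrightarrow> e \<in> D \<Longrightarrow> x \<in> convex hull D \<Longrightarrow> y \<in> convex hull D
    \<Longrightarrow> dist (contr r d x) (contr r e y) < g \<Longrightarrow> d = e"
    using contr_hull_gap[OF indep r] by metis
  have *: "\<exists>\<delta>>0. \<exists>c. \<forall>x\<in>?K. dist x (c x) \<le> r ^ n * M \<and> (\<forall>y\<in>?K. dist x y < \<delta> \<longrightarrow> c x = c y)" for n
  proof (induction n)
    case 0
    obtain d where "d \<in> ?K" using \<open>D \<noteq> {}\<close> digits_subset_attractor by blast
    then show ?case
      using diameter_bounded_bound[OF bd] unfolding M_def
      by (intro exI[of _ 1] conjI exI[of _ "\<lambda>_. d"]) auto
  next
    case (Suc n)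
    then obtain \<delta> c where \<delta>: "\<delta> > 0" and c: "\<And>x. x \<in> ?K \<Longrightarrow> dist x (c x) \<le> r ^ n * M"
      and l: "\<And>x y. x \<in> ?K \<Longrightarrow> y \<in> ?K \<Longrightarrow> dist x y < \<delta> \<Longrightarrow> c x = c y"
      by blast
    have "\<forall>x\<in>?K. \<exists>d y. d \<in> D \<and> y \<in> ?K \<and> x = contr r d y"
      using attractorE[OF indep r] by metis
    then obtain p q where pq: "\<And>x. x \<in> ?K \<Longrightarrow> p x \<in> D \<and> q x \<in> ?K \<and> x = contr r (p x) (q x)"
      by metis
    show ?case
    proof (intro exI[of _ "min g (r * \<delta>)"] conjI exI[of _ "\<lambda>x. contr r (p x) (c (q x))"] ballI impI)
      show "min g (r * \<delta>) > 0" using g(1) \<delta> r by simp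
    next
      fix x assume x: "x \<in> ?K"
      have "dist x (contr r (p x) (c (q x))) = dist (contr r (p x) (q x)) (contr r (p x) (c (q x)))"
        using pq[OF x] by simp
      also have "\<dots> = r * dist (q x) (c (q x))" using r by (intro dist_contr) simp
      also have "\<dots> \<le> r * (r ^ n * M)" using c pq[OF x] r by (intro mult_left_mono) auto
      finally show "dist x (contr r (p x) (c (q x))) \<le> r ^ Suc n * M" by simp
    next
      fix x y assume x: "x \<in> ?K" and y: "y \<in> ?K" and xy: "dist x y < min g (r * \<delta>)"
      have px: "p x \<in> D" "q x \<in> ?K" "x = contr r (p x) (q x)" using pq[OF x] by auto
      have py: "p y \<in> D" "q y \<in> ?K" "y = contr r (p y) (q y)" using pq[OF y] by auto
      have "dist (contr r (p x) (q x)) (contr r (p y) (q y)) < g" using px(3) py(3) xy by simp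
      then have eq: "p x = p y"
        using g(2)[OF px(1) py(1)] px(2) py(2) attractor_subset by blast
      have "dist (contr r (p x) (q x)) (contr r (p x) (q y)) < r * \<delta>"
        using px(3) py(3) xy eq by simp
      then have "dist (q x) (q y) < \<delta>" using r by (simp add: dist_contr)
      then show "contr r (p x) (c (q x)) = contr r (p y) (c (q y))"
        using l[OF px(2) py(2)] eq by simp
    qed
  qed
  show ?thesis
    unfolding small_chunks_def
  proof (intro allI impI)
    fix e :: real assume "e > 0"
    obtain n where "r ^ n * M < e"
      using power_times_less[of r e M] r \<open>e > 0\<close> by auto
    then show "\<exists>d>0. \<exists>c. \<forall>x\<in>?K. dist x (c x) < e \<and> (\<forall>y\<in>?K. dist x y < d \<longrightarrow> c x = c y)"
      using *[of n] by (meson order_le_less_trans)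
  qed
qed

text \<open>The two inequalities say that the three images of the interval \<open>[f a, f b]\<close> cover it.\<close>

lemma attractor_linear_image:
  fixes f :: "'a::euclidean_space \<Rightarrow> real"
  assumes f: "linear f" and D: "finite D" "a \<in> D" "b \<in> D" "g \<in> D" and r: "0 < r" "r \<le> 1"
    and le: "(1 - r) * (f g - f a) \<le> r * (f b - f a)" "(1 - r) * (f b - f g) \<le> r * (f b - f a)"
    and t: "f a \<le> t" "t \<le> f b"
  shows "\<exists>x\<in>attractor r D. f x = t"
proof -
  \<comment> \<open>The value \<open>t\<close> is first found in each stage separately; compactness
    later carries it over to the intersection.\<close>
  have stage: "\<exists>x\<in>stage r D n. f x = t" if "f a \<le> t" "t \<le> f b" for n t
    using that
  proof (induction n arbitrary: t)
    case 0
    have "connected (f ` (convex hull D))"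
      using f by (intro connected_continuous_image linear_continuous_on convex_connected)
        (auto simp: linear_conv_bounded_linear)
    moreover have "f a \<in> f ` (convex hull D)" "f b \<in> f ` (convex hull D)"
      using D by (auto simp: hull_inc)
    ultimately have "t \<in> f ` (convex hull D)" using 0 by (metis connectedD_interval)
    then show ?case by auto
  next
    case (Suc n)
    have "\<exists>d\<in>D. r * f a + (1 - r) * f d \<le> t \<and> t \<le> r * f b + (1 - r) * f d"
    proof -
      \<comment> \<open>Either \<open>t\<close> lies in the interval contracted towards
        \<open>f a\<close> or towards \<open>f b\<close>, or it lies in the gap between these two,
        which \<open>le\<close> places inside the interval contracted towards
        \<open>f g\<close>.\<close>
      consider "t \<le> r * f b + (1 - r) * f a" | "r * f a + (1 - r) * f b \<le> t"
        | "r * f b + (1 - r) * f a \<le> t" "t \<le> r * f a + (1 - r) * f b" by linarith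
      then show ?thesis
      proof cases
        case 1
        then show ?thesis using Suc.prems D by (intro bexI[of _ a]) (auto simp: algebra_simps)
      next
        case 2
        then show ?thesis using Suc.prems D by (intro bexI[of _ b]) (auto simp: algebra_simps)
      next
        case 3
        then show ?thesis using le D by (intro bexI[of _ g]) (auto simp: algebra_simps)
      qed
    qed
    then obtain d where d: "d \<in> D" "r * f a + (1 - r) * f d \<le> t" "t \<le> r * f b + (1 - r) * f d"
      by blast
    then have "f a \<le> (t - (1 - r) * f d) / r" "(t - (1 - r) * f d) / r \<le> f b"
      using r by (auto simp: field_simps)
    then obtain x where x: "x \<in> stage r D n" "f x = (t - (1 - r) * f d) / r"
      using Suc.IH by blast
    have "f (contr r d x) = t"
      using x(2) r by (simp add: contr_def linear_add[OF f] linear_scale[OF f])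
    moreover have "contr r d x \<in> stage r D (Suc n)" using d(1) x(1) by auto
    ultimately show ?case by blast
  qed
  \<comment> \<open>The slices of the stages at height \<open>t\<close> are nested nonempty compact
    sets.\<close>
  have "(\<Inter>n. stage r D n \<inter> f -` {t}) \<noteq> {}"
  proof (rule compact_nest)
    show "compact (stage r D n \<inter> f -` {t})" for n
      using f by (intro compact_Int_closed compact_stage D closed_vimage linear_continuous_on)
        (auto simp: linear_conv_bounded_linear linear_continuous_on)
    show "stage r D n \<inter> f -` {t} \<noteq> {}" for n using stage[OF t] by auto
    show "stage r D n \<inter> f -` {t} \<subseteq> stage r D m \<inter> f -` {t}" if "m \<le> n" for m n
      using stage_antimono[OF _ r(2) that] r by auto
  qed
  then show ?thesis by (auto simp: attractor_def)
qed

section \<open>The middle-thirds set and the criterion for Cantor sets\<close>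

text \<open>The maps \<open>x / 3\<close> and \<open>(2 + x) / 3\<close> are the homotheties of
  ratio \<open>1/3\<close> with centres \<open>0\<close> and \<open>1\<close>, so the results on
  attractors apply to the model as well.\<close>

lemma middle_thirds_eq_attractor: "middle_thirds_set = attractor (1/3) {0, 1}"
proof -
  have "convex hull {0, 1 :: real} = {0..1}"
    by (simp add: closed_segment_eq_real_ivl flip: segment_convex_hull)
  then have "middle_thirds_stage n = stage (1/3) {0, 1} n" for n
    by (induction n) (auto simp: contr_def field_simps)
  then show ?thesis by (simp add: middle_thirds_set_def attractor_def)
qed

text \<open>Both \<open>K\<close> and the middle-thirds set are homeomorphic to the space of binary
  sequences.\<close>

lemma cantor_setI:
  fixes K :: "'a::metric_space set"
  assumes "compact K" "K \<noteq> {}" "small_chunks K" "\<And>x. x \<in> K \<Longrightarrow> x islimpt K"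
  shows "cantor_set K"
proof -
  have indep: "\<not> affine_dependent {0, 1 :: real}" by (rule affine_independent_2)
  have "attractor (1/3) {0, 1 :: real} homeomorphic {f :: nat \<Rightarrow> real. \<forall>n. f n \<in> {0, 1}}"
  proof (rule small_chunks_homeomorphic)
    show "attractor (1/3) {0, 1 :: real} \<noteq> {}" using digits_subset_attractor by blast
    show "small_chunks (attractor (1/3) {0, 1 :: real})"
      by (rule small_chunks_attractor[OF indep]) auto
    show "x islimpt attractor (1/3) {0, 1}" if "x \<in> attractor (1/3) {0, 1}" for x :: real
      by (rule attractor_islimpt[OF indep, of _ 0 1]) (use that in auto)
  qed (auto intro: compact_attractor)
  then show ?thesis
    unfolding cantor_set_def middle_thirds_eq_attractor
    using small_chunks_homeomorphic[OF assms] homeomorphic_sym homeomorphic_trans by blast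
qed

subsection \<open>Triangles\<close>

definition centroid :: "'a::real_vector set \<Rightarrow> 'a" where
  "centroid V = (1 / 3) *\<^sub>R \<Sum>V"

text \<open>Every vertex is left out in turn, because which vertex has the middle value depends on
  the functional.\<close>

definition triangle_dust :: "'a::euclidean_space set \<Rightarrow> 'a set" where
  "triangle_dust V = (\<Union>b\<in>V. attractor (2/5) (insert (centroid V) (V - {b})))"

lemma centroid_3: "a \<noteq> b \<Longrightarrow> b \<noteq> c \<Longrightarrow> a \<noteq> c \<Longrightarrow> centroid {a, b, c} = (1/3) *\<^sub>R (a + b + c)"
  by (simp add: centroid_def add.assoc)

text \<open>These facts make the attractors in \<open>triangle_dust\<close> totally disconnected,
  contained in the triangle and perfect, respectively.\<close>

lemma centroid_digits:
  fixes V :: "'a::euclidean_space set"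
  assumes V: "\<not> affine_dependent V" "card V = 3" and b: "b \<in> V"
  shows "\<not> affine_dependent (insert (centroid V) (V - {b}))"
    and "centroid V \<in> convex hull V" and "\<exists>a c. a \<noteq> c \<and> {a, c} \<subseteq> V - {b}"
proof -
  have "card (V - {b}) = 2" using V b by (simp add: card_Diff_singleton)
  then obtain a c where ac: "V - {b} = {a, c}" "a \<noteq> c" by (auto simp: card_2_iff)
  then have Veq: "V = {a, b, c}" and dist: "a \<noteq> b" "b \<noteq> c" using b by auto
  then show "\<exists>a c. a \<noteq> c \<and> {a, c} \<subseteq> V - {b}" using ac by blast
  have cen: "centroid V = (1/3) *\<^sub>R (a + b + c)" using centroid_3 Veq dist ac by blast
  then have eq: "centroid V = (1/3) *\<^sub>R a + (1/3) *\<^sub>R b + (1/3) *\<^sub>R c"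
    by (simp add: scaleR_add_right)
  show "centroid V \<in> convex hull V"
    unfolding eq unfolding Veq convex_hull_3 by force
  have bn: "b \<notin> affine hull {a, c}"
    using V(1) b ac unfolding affine_dependent_def by metis
  have "centroid V \<notin> affine hull {a, c}"
  proof
    assume "centroid V \<in> affine hull {a, c}"
    then obtain u v where uv: "u + v = 1" "centroid V = u *\<^sub>R a + v *\<^sub>R c"
      by (auto simp: affine_hull_2)
    \<comment> \<open>If the centroid were on the line through \<open>a\<close> and
      \<open>c\<close>, then so would be \<open>b\<close>: the coefficients obtained below sum to
      \<open>3 * (u + v) - 2 = 1\<close>.\<close>
    have "b = 3 *\<^sub>R centroid V - a - c" by (simp add: cen)
    also have "\<dots> = (3 * u - 1) *\<^sub>R a + (3 * v - 1) *\<^sub>R c"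
      unfolding uv(2) by (simp add: algebra_simps)
    finally have "b \<in> affine hull {a, c}"
      unfolding affine_hull_2 using uv(1) by force
    then show False using bn by blast
  qed
  then show "\<not> affine_dependent (insert (centroid V) (V - {b}))"
    using affine_independent_insert[OF affine_independent_2] ac by metis
qed

lemma triangle_dust:
  fixes V :: "'a::euclidean_space set"
  assumes V: "\<not> affine_dependent V" "card V = 3"
  shows "compact (triangle_dust V)" "small_chunks (triangle_dust V)"
    "triangle_dust V \<subseteq> convex hull V"
    "x \<in> triangle_dust V \<Longrightarrow> x islimpt triangle_dust V"
proof -
  have fin: "finite V" using V(2) card.infinite by force
  note dig = centroid_digits[OF V]
  show "compact (triangle_dust V)" unfolding triangle_dust_def
    using fin by (intro compact_UN compact_attractor) auto
  show "small_chunks (triangle_dust V)" unfolding triangle_dust_def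
    using fin dig(1) by (intro small_chunks_UN small_chunks_attractor) auto
  show "triangle_dust V \<subseteq> convex hull V" unfolding triangle_dust_def
  proof (intro UN_least)
    fix b assume "b \<in> V"
    then have "insert (centroid V) (V - {b}) \<subseteq> convex hull V"
      using dig(2) by (auto intro: hull_inc)
    then have "convex hull (insert (centroid V) (V - {b})) \<subseteq> convex hull V"
      by (simp add: subset_hull)
    then show "attractor (2/5) (insert (centroid V) (V - {b})) \<subseteq> convex hull V"
      using attractor_subset by blast
  qed
  show "x islimpt triangle_dust V" if x: "x \<in> triangle_dust V"
  proof -
    obtain b where b: "b \<in> V" "x \<in> attractor (2/5) (insert (centroid V) (V - {b}))"
      using x unfolding triangle_dust_def by blast
    obtain a c where ac: "a \<noteq> c" "{a, c} \<subseteq> V - {b}" using dig(3)[OF b(1)] by blast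
    have "x islimpt attractor (2/5) (insert (centroid V) (V - {b}))"
      by (rule attractor_islimpt[OF dig(1)[OF b(1)], of _ a c]) (use ac b in auto)
    then show ?thesis
      by (rule islimpt_subset) (use b in \<open>auto simp: triangle_dust_def\<close>)
  qed
qed

text \<open>If \<open>f a \<le> f b \<le> f c\<close>, the value of \<open>f\<close> at the centroid lies in the middle third of
  \<open>[f a, f c]\<close>, which is exactly what ratio \<open>2/5\<close> needs.\<close>

lemma triangle_dust_linear_image:
  fixes V :: "'a::euclidean_space set" and f :: "'a \<Rightarrow> real"
  assumes V: "\<not> affine_dependent V" "card V = 3" and f: "linear f" and x: "x \<in> convex hull V"
  shows "\<exists>y\<in>triangle_dust V. f y = f x"
proof -
  obtain a b c where abc: "V = {a, b, c}" "a \<noteq> b" "b \<noteq> c" "a \<noteq> c" "f a \<le> f b" "f b \<le> f c"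
  proof -
    obtain p q r where pqr: "V = {p, q, r}" "p \<noteq> q" "q \<noteq> r" "p \<noteq> r"
      using V(2) by (auto simp: card_3_iff)
    have perm: "{p, q, r} = {p, r, q}" "{p, q, r} = {q, p, r}" "{p, q, r} = {q, r, p}"
      "{p, q, r} = {r, p, q}" "{p, q, r} = {r, q, p}" by auto
    \<comment> \<open>The six orderings of the three values; \<open>b\<close> becomes the vertex
      with the middle one, which is omitted in \<open>?D\<close>.\<close>
    consider "f p \<le> f q" "f q \<le> f r" | "f p \<le> f r" "f r \<le> f q" | "f q \<le> f p" "f p \<le> f r"
      | "f q \<le> f r" "f r \<le> f p" | "f r \<le> f p" "f p \<le> f q" | "f r \<le> f q" "f q \<le> f p"
      by linarith
    then show thesis using that pqr perm by cases metis+
  qed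
  let ?D = "insert (centroid V) (V - {b})"
  have cen: "f (centroid V) = (f a + f b + f c) / 3"
    using abc by (simp add: centroid_3 linear_add[OF f] linear_scale[OF f])
  have "convex hull V \<subseteq> f -` {f a..f c}"
    using abc by (intro hull_minimal convex_linear_vimage f) auto
  then have fx: "f a \<le> f x" "f x \<le> f c" using x by auto
  have "\<exists>y\<in>attractor (2/5) ?D. f y = f x"
  proof (rule attractor_linear_image[of f ?D a c "centroid V" "2/5" "f x", OF f])
    show "(1 - 2/5) * (f (centroid V) - f a) \<le> 2/5 * (f c - f a)"
      "(1 - 2/5) * (f c - f (centroid V)) \<le> 2/5 * (f c - f a)"
      unfolding cen using abc(5,6) by argo+
  qed (use abc fx in auto)
  then show ?thesis using abc unfolding triangle_dust_def by blast
qed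

section \<open>Projections onto lines and the union of triangles\<close>

text \<open>The condition defining the foot involves the projected point only through inner products
  with differences of points of \<open>l\<close>, so for \<open>x\<close> and \<open>y\<close> it is
  the same condition.\<close>

lemma orth_proj_cong:
  assumes "\<And>z w. z \<in> l \<Longrightarrow> w \<in> l \<Longrightarrow> (x - y) \<bullet> (z - w) = 0"
  shows "orth_proj l x = orth_proj l y"
proof -
  have "(x - w) \<bullet> (z - w) = (y - w) \<bullet> (z - w)" if "z \<in> l" "w \<in> l" for z w
    using assms[OF that] by (simp add: inner_diff_left)
  then show ?thesis unfolding orth_proj_def by metis
qed

text \<open>With \<open>orth_proj_cong\<close> this reduces projecting onto \<open>l\<close> to the
  single functional \<open>x \<bullet> v\<close>. The direction is the difference of two points that
  affinely span \<open>l\<close>.\<close>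

lemma line_direction:
  fixes l :: "'a::euclidean_space set"
  assumes "affine l" "aff_dim l = 1"
  obtains v where "\<And>z w. z \<in> l \<Longrightarrow> w \<in> l \<Longrightarrow> \<exists>t. z - w = t *\<^sub>R v"
proof -
  obtain B where B: "\<not> affine_dependent B" "affine hull B = l"
    using affine_basis_exists[of l] affine_hull_eq[of l] assms(1) by metis
  then have "card B = 2" using aff_dim_unique[of B l] assms(2) by force
  then obtain p q where "B = {p, q}" by (auto simp: card_2_iff)
  then have l: "l = {u *\<^sub>R p + v *\<^sub>R q |u v. u + v = 1}" using B(2) affine_hull_2 by blast
  show thesis
  proof (rule that[of "q - p"])
    fix z w assume "z \<in> l" "w \<in> l"
    then obtain u v u' v' where z: "z = u *\<^sub>R p + v *\<^sub>R q" "u + v = 1"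
      and w: "w = u' *\<^sub>R p + v' *\<^sub>R q" "u' + v' = 1"
      unfolding l by blast
    then have u: "u = 1 - v" "u' = 1 - v'" by simp_all
    have "z - w = (v - v') *\<^sub>R (q - p)" unfolding z(1) w(1) u by (simp add: algebra_simps)
    then show "\<exists>t. z - w = t *\<^sub>R (q - p)" ..
  qed
qed

theorem mainTheorem5:
  fixes L :: "(real ^ 2) set"
  assumes "\<exists>\<T>. finite \<T> \<and> \<T> \<noteq> {} \<and> (\<forall>T\<in>\<T>. 2 simplex T) \<and> L = \<Union>\<T>"
  shows "\<exists>K :: (real ^ 2) set. cantor_set K \<and>
           (\<forall>l :: (real ^ 2) set. affine l \<and> aff_dim l = 1 \<longrightarrow> orth_proj l ` K = orth_proj l ` L)"
proof -
  obtain \<T> where \<T>: "finite \<T>" "\<T> \<noteq> {}" "\<And>T. T \<in> \<T> \<Longrightarrow> 2 simplex T" "L = \<Union>\<T>"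
    using assms by blast
  have "\<forall>T\<in>\<T>. \<exists>V. \<not> affine_dependent V \<and> card V = 3 \<and> T = convex hull V"
    using \<T>(3) unfolding simplex_def by fastforce
  then obtain V where V: "\<And>T. T \<in> \<T> \<Longrightarrow> \<not> affine_dependent (V T)"
    "\<And>T. T \<in> \<T> \<Longrightarrow> card (V T) = 3" "\<And>T. T \<in> \<T> \<Longrightarrow> T = convex hull (V T)"
    by metis
  define K where "K = (\<Union>T\<in>\<T>. triangle_dust (V T))"
  have KL: "K \<subseteq> L" unfolding K_def \<T>(4) using triangle_dust(3) V by blast
  \<comment> \<open>One set \<open>K\<close> serves all functionals at once, as each triangle is
    matched by its own dust.\<close>
  have hit: "\<exists>y\<in>K. f y = f x" if "linear f" "x \<in> L" for f :: "real ^ 2 \<Rightarrow> real" and x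
  proof -
    obtain T where T: "T \<in> \<T>" "x \<in> T" using \<open>x \<in> L\<close> \<T>(4) by blast
    then show ?thesis
      using triangle_dust_linear_image[OF V(1,2)[OF T(1)] that(1), of x] V(3)[OF T(1)]
      unfolding K_def by blast
  qed
  have "L \<noteq> {}"
  proof -
    obtain T where T: "T \<in> \<T>" using \<T>(2) by blast
    then have "V T \<noteq> {}" using V(2) by force
    then have "T \<noteq> {}" using V(3)[OF T] by (metis convex_hull_eq_empty)
    then show ?thesis using T \<T>(4) by blast
  qed
  \<comment> \<open>The zero functional at any point of \<open>L\<close> already yields a point of
    \<open>K\<close>.\<close>
  then have "K \<noteq> {}" using hit[OF linear_zero] by blast
  have "cantor_set K"
  proof (rule cantor_setI)
    show "compact K" unfolding K_def 
      using \<T>(1) triangle_dust(1)[OF V(1,2)] by (intro compact_UN)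
    show "small_chunks K" unfolding K_def
      using \<T>(1) triangle_dust(2)[OF V(1,2)] by (intro small_chunks_UN)
    show "x islimpt K" if "x \<in> K" for x
    proof -
      obtain T where T: "T \<in> \<T>" "x \<in> triangle_dust (V T)" using \<open>x \<in> K\<close> unfolding K_def by blast
      have "x islimpt triangle_dust (V T)" using triangle_dust(4)[OF V(1,2)[OF T(1)] T(2)] .
      then show ?thesis by (rule islimpt_subset) (use T in \<open>auto simp: K_def\<close>)
    qed
  qed fact
  moreover have "orth_proj l ` K = orth_proj l ` L" if l: "affine l" "aff_dim l = 1" for l
  proof (intro equalityI subsetI)
    fix p assume "p \<in> orth_proj l ` L"
    then obtain x where x: "x \<in> L" "p = orth_proj l x" by blast
    obtain v where v: "\<And>z w. z \<in> l \<Longrightarrow> w \<in> l \<Longrightarrow> \<exists>t. z - w = t *\<^sub>R v"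
      using line_direction[OF l] by blast
    \<comment> \<open>A point of \<open>K\<close> with the same inner product with \<open>v\<close>
      as \<open>x\<close> has the same projection; the converse inclusion follows from
      \<open>KL\<close>.\<close>
    have "linear (\<lambda>x. x \<bullet> v)" by (simp add: bounded_linear.linear bounded_linear_inner_left)
    then obtain y where y: "y \<in> K" "y \<bullet> v = x \<bullet> v" using hit x(1) by blast
    have "orth_proj l y = orth_proj l x"
    proof (rule orth_proj_cong)
      fix z w assume "z \<in> l" "w \<in> l"
      then obtain t where "z - w = t *\<^sub>R v" using v by blast
      then show "(y - x) \<bullet> (z - w) = 0" using y(2) by (simp add: inner_diff_left)
    qed
    then show "p \<in> orth_proj l ` K" using x(2) y(1) by (metis imageI)
  qed (use KL in auto)
  ultimately show ?thesis by (intro exI[of _ K] conjI allI impI) simp_all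
qed

end
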